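(* Let $\Omega$ be a symmetric open subset of $\mathbb{H}$ and take distinct $J,K\in\mathbb{S}$. Consider holomorphic functions $r:\Omega_J^{\geqslant}\to\mathbb{H}$ and $s:\Omega_K^{\geqslant}\to\mathbb{H}$ and assume the equality $r(\alpha)=s(\alpha)$ to hold for all $\alpha\in\Omega\cap\mathbb{R}$ (if any). Set $D:=\phi_J^{-1}(\Omega_J)\subseteq\mathbb{R}_{\mathbb{C}}$ (so that $\Omega=\Omega_D$). Define $F:D\to\mathbb{H}_{\mathbb{C}}$ by setting, for all $z=\alpha+\imath\beta\in D$ with $\beta\ge0$, \[F(\alpha+\imath\beta):=(J-K)^{-1}\left[Jr(\alpha+\beta J)-Ks(\alpha+\beta K)\right]+\imath(J-K)^{-1}\left[r(\alpha+\beta J)-s(\alpha+\beta K)\right]\] as well as $F(\bar z):=\overline{F(z)}$. Then $F$ is a well-defined holomorphic stem function. It induces an element of $\mathcal{SR}(\Omega)$ (whence a slice regular function), namely $f:=\mathcal{I}(F):\Omega\to\mathbb{H}$, such that $r=f_{|\Omega_J^{\geqslant}}$ and $s=f_{|\Omega_K^{\geqslant}}$.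
   Context: $\mathbb{H}$ is the algebra of quaternions (Euclidean topology), $\mathbb{S}=\{w\in\mathbb{H}: w^2=-1\}$. For $I\in\mathbb{S}$: $\mathbb{C}_I=\mathbb{R}+\mathbb{R}I$, $\mathbb{C}_I^{\geqslant}=\{\alpha+\beta I:\alpha,\beta\in\mathbb{R},\beta\ge0\}$. For $T\subseteq\mathbb{H}$: $T_I=T\cap\mathbb{C}_I$, $T_I^{\geqslant}=T\cap\mathbb{C}_I^{\geqslant}$. $T$ is symmetric if $\alpha+\beta I\in T$ ($\alpha,\beta\in\mathbb{R}$, $I\in\mathbb{S}$) implies $\alpha+\beta\mathbb{S}\subseteq T$. A $C^1$ function $g$ from an open $V\subseteq\mathbb{C}_I$ to $\mathbb{H}$ is holomorphic if $\left(\frac{\partial}{\partial\alpha}+I\frac{\partial}{\partial\beta}\right)g(\alpha+\beta I)=0$ on $V$. A function $r:T_I^{\geqslant}\to\mathbb{H}$ is holomorphic if it is the restriction of a holomorphic function $V\to\mathbb{H}$ for some open neighborhood $V$ of $T_I^{\geqslant}$ in $\mathbb{C}_I$. A function $f$ on an open subset $\Omega$ of $\mathbb{H}$ is slice regular if $f_{|\Omega_I}$ is holomorphic for every $I\in\mathbb{S}$. $\mathbb{H}_{\mathbb{C}}=\mathbb{H}\otimes_{\mathbb{R}}\mathbb{C}=\{x+\imath y: x,y\in\mathbb{H}\}$, with $\imath$ central and $\imath^2=-1$; $\overline{x+\imath y}=x-\imath y$; $\mathbb{R}_{\mathbb{C}}=\mathbb{R}+\imath\mathbb{R}\subset\mathbb{H}_{\mathbb{C}}$.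 For $J\in\mathbb{S}$, $\phi_J:\mathbb{R}_{\mathbb{C}}\to\mathbb{C}_J$ is the bijection $\alpha+\imath\beta\mapsto\alpha+\beta J$. For $D\subseteq\mathbb{R}_{\mathbb{C}}$, the circularization is $\Omega_D=\{\alpha+\beta I:\alpha+\imath\beta\in D, I\in\mathbb{S}\}$. If $D\subseteq\mathbb{R}_{\mathbb{C}}$ is preserved by conjugation, a stem function is $F=F_1+\imath F_2:D\to\mathbb{H}_{\mathbb{C}}$ ($F_1,F_2$ being $\mathbb{H}$-valued) with $F(\bar z)=\overline{F(z)}$; for $D$ open, it is holomorphic if it is so with respect to multiplication by $\imath$ on $D$ and on $\mathbb{H}_{\mathbb{C}}$. It induces $\mathcal{I}(F):\Omega_D\to\mathbb{H}$, $\mathcal{I}(F)(\alpha+\beta I)=F_1(\alpha+\imath\beta)+IF_2(\alpha+\imath\beta)$. $\mathcal{SR}(\Omega_D)$ is the set of functions $\mathcal{I}(F)$ with $F:D\to\mathbb{H}_{\mathbb{C}}$ a holomorphic stem function. *)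

theory Defs
  imports "HOL-Complex_Analysis.Complex_Analysis"
begin

section \<open>The quaternions\<close>

datatype quat = Quat (qRe: real) (qI: real) (qJ: real) (qK: real)

lemma quat_eq_iff:
  "x = y \<longleftrightarrow> qRe x = qRe y \<and> qI x = qI y \<and> qJ x = qJ y \<and> qK x = qK y"
  by (cases x; cases y) auto

instantiation quat :: ab_group_add
begin

definition "0 = Quat 0 0 0 0"
definition "x + y = Quat (qRe x + qRe y) (qI x + qI y) (qJ x + qJ y) (qK x + qK y)"
definition "- x = Quat (- qRe x) (- qI x) (- qJ x) (- qK x)"
definition "x - (y::quat) = Quat (qRe x - qRe y) (qI x - qI y) (qJ x - qJ y) (qK x - qK y)"

lemma quat_add_sel [simp]:
  "qRe 0 = 0" "qI 0 = 0" "qJ 0 = 0" "qK 0 = 0"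
  "qRe (x + y) = qRe x + qRe y" "qI (x + y) = qI x + qI y"
  "qJ (x + y) = qJ x + qJ y" "qK (x + y) = qK x + qK y"
  "qRe (- x) = - qRe x" "qI (- x) = - qI x" "qJ (- x) = - qJ x" "qK (- x) = - qK x"
  "qRe (x - y) = qRe x - qRe y" "qI (x - y) = qI x - qI y"
  "qJ (x - y) = qJ x - qJ y" "qK (x - y) = qK x - qK y"
  by (simp_all add: zero_quat_def plus_quat_def uminus_quat_def minus_quat_def)

instance by standard (simp_all add: quat_eq_iff)

end

instantiation quat :: ring_1
begin

definition "1 = Quat 1 0 0 0"
definition "x * y = Quat
  (qRe x * qRe y - qI x * qI y - qJ x * qJ y - qK x * qK y)
  (qRe x * qI y + qI x * qRe y + qJ x * qK y - qK x * qJ y)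
  (qRe x * qJ y - qI x * qK y + qJ x * qRe y + qK x * qI y)
  (qRe x * qK y + qI x * qJ y - qJ x * qI y + qK x * qRe y)"

lemma quat_mult_sel [simp]:
  "qRe 1 = 1" "qI 1 = 0" "qJ 1 = 0" "qK 1 = 0"
  "qRe (x * y) = qRe x * qRe y - qI x * qI y - qJ x * qJ y - qK x * qK y"
  "qI (x * y) = qRe x * qI y + qI x * qRe y + qJ x * qK y - qK x * qJ y"
  "qJ (x * y) = qRe x * qJ y - qI x * qK y + qJ x * qRe y + qK x * qI y"
  "qK (x * y) = qRe x * qK y + qI x * qJ y - qJ x * qI y + qK x * qRe y"
  by (simp_all add: one_quat_def times_quat_def)

instance by standard (simp_all add: quat_eq_iff algebra_simps)

end

instantiation quat :: real_vector
begin

definition "scaleR r x = Quat (r * qRe x) (r * qI x) (r * qJ x) (r * qK x)"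

lemma quat_scaleR_sel [simp]:
  "qRe (r *\<^sub>R x) = r * qRe x" "qI (r *\<^sub>R x) = r * qI x"
  "qJ (r *\<^sub>R x) = r * qJ x" "qK (r *\<^sub>R x) = r * qK x"
  by (simp_all add: scaleR_quat_def)

instance by standard (simp_all add: quat_eq_iff algebra_simps)

end

instantiation quat :: real_inner
begin

definition "inner x y = qRe x * qRe y + qI x * qI y + qJ x * qJ y + qK x * qK y"
definition "norm x = sqrt ((qRe x)\<^sup>2 + (qI x)\<^sup>2 + (qJ x)\<^sup>2 + (qK x)\<^sup>2)"
definition "sgn x = x /\<^sub>R norm (x::quat)"
definition "dist x y = norm (x - y :: quat)"
definition "(uniformity :: (quat \<times> quat) filter) =
  (INF e\<in>{0<..}. principal {(x, y). dist x y < e})"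
definition "open (U :: quat set) \<longleftrightarrow>
  (\<forall>x\<in>U. eventually (\<lambda>(x', y). x' = x \<longrightarrow> y \<in> U) uniformity)"

instance
proof
  fix r s :: real and x y z :: quat and U :: "quat set"
  show "dist x y = norm (x - y)" by (rule dist_quat_def)
  show "sgn x = x /\<^sub>R norm x" by (rule sgn_quat_def)
  show "(uniformity :: (quat \<times> quat) filter) =
    (INF e\<in>{0<..}. principal {(x, y). dist x y < e})" by (rule uniformity_quat_def)
  show "open U \<longleftrightarrow> (\<forall>x\<in>U. eventually (\<lambda>(x', y). x' = x \<longrightarrow> y \<in> U) uniformity)"
    by (rule open_quat_def)
  show "norm x = sqrt (inner x x)"
    by (simp add: norm_quat_def inner_quat_def power2_eq_square)
  show "0 \<le> inner x x" by (simp add: inner_quat_def)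
  show "(inner x x = 0) = (x = 0)"
  proof
    assume "inner x x = 0"
    moreover have "0 \<le> qRe x * qRe x" "0 \<le> qI x * qI x" "0 \<le> qJ x * qJ x" "0 \<le> qK x * qK x"
      by simp_all
    ultimately have "qRe x * qRe x = 0" "qI x * qI x = 0" "qJ x * qJ x = 0" "qK x * qK x = 0"
      unfolding inner_quat_def by linarith+
    then show "x = 0" by (simp add: quat_eq_iff)
  qed (simp add: inner_quat_def)
qed (simp_all add: quat_eq_iff inner_quat_def algebra_simps)

end

lemma quat_norm_mult: "norm (x * y :: quat) = norm x * norm y"
  unfolding norm_quat_def real_sqrt_mult[symmetric]
  by (rule arg_cong[where f = sqrt]) (simp add: power2_eq_square algebra_simps)

instantiation quat :: real_normed_div_algebra
begin

definition "inverse x = Quat (qRe x) (- qI x) (- qJ x) (- qK x) /\<^sub>R (norm x)\<^sup>2"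
definition "x div (y::quat) = x * inverse y"

instance
proof
  fix r :: real and x y :: quat
  have n: "(norm z)\<^sup>2 = qRe z * qRe z + qI z * qI z + qJ z * qJ z + qK z * qK z" for z :: quat
    by (simp add: norm_quat_def power2_eq_square)
  show "r *\<^sub>R x * y = r *\<^sub>R (x * y)" "x * r *\<^sub>R y = r *\<^sub>R (x * y)"
    by (simp_all add: quat_eq_iff algebra_simps)
  show "inverse (0::quat) = 0" by (simp add: inverse_quat_def quat_eq_iff)
  show "x div y = x * inverse y" by (rule divide_quat_def)
  show "norm (x * y) = norm x * norm y" by (rule quat_norm_mult)
  assume "x \<noteq> 0"
  then have nz: "(norm x)\<^sup>2 \<noteq> 0" by simp
  let ?c = "Quat (qRe x) (- qI x) (- qJ x) (- qK x)"
  have "?c * x = (norm x)\<^sup>2 *\<^sub>R 1" "x * ?c = (norm x)\<^sup>2 *\<^sub>R 1"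
    unfolding n by (simp_all add: quat_eq_iff algebra_simps)
  moreover have "(r *\<^sub>R ?c) * x = r *\<^sub>R (?c * x)" "x * (r *\<^sub>R ?c) = r *\<^sub>R (x * ?c)" for r
    by (simp_all add: quat_eq_iff algebra_simps)
  ultimately show "inverse x * x = 1" "x * inverse x = 1"
    using nz by (simp_all add: inverse_quat_def del: mult_eq_0_iff)
qed

end

instantiation quat :: euclidean_space
begin

definition "Basis = {Quat 1 0 0 0, Quat 0 1 0 0, Quat 0 0 1 0, Quat 0 0 0 1}"

instance
proof
  show "Basis \<noteq> ({} :: quat set)" "finite (Basis :: quat set)"
    by (simp_all add: Basis_quat_def)
  fix u v x :: quat
  show "inner u v = (if u = v then 1 else 0)" if "u \<in> Basis" "v \<in> Basis"
    using that unfolding Basis_quat_def by (elim insertE emptyE) (simp_all add: inner_quat_def)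
  show "(\<forall>u\<in>Basis. inner x u = 0) \<longleftrightarrow> x = 0"
    unfolding quat_eq_iff[of x] by (simp add: Basis_quat_def inner_quat_def)
qed

end

section \<open>Slices, symmetric sets and slice regular functions\<close>

definition imag_units :: "quat set"  (\<open>\<S>\<close>) where
  "\<S> = {w. w\<^sup>2 = -1}"

definition phi :: "quat \<Rightarrow> complex \<Rightarrow> quat"  (\<open>\<phi>\<close>) where
  \<comment> \<open>The algebra \<open>R + \<iota>R\<close> is represented by the type \<open>complex\<close>.\<close>
  "\<phi> I z = of_real (Re z) + of_real (Im z) * I"

definition slice_plane :: "quat \<Rightarrow> quat set" where
  "slice_plane I = {of_real \<alpha> + of_real \<beta> * I | \<alpha> \<beta>. True}"

definition slice_half_plane :: "quat \<Rightarrow> quat set" where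
  "slice_half_plane I = {of_real \<alpha> + of_real \<beta> * I | \<alpha> \<beta>. \<beta> \<ge> 0}"

definition symmetric :: "quat set \<Rightarrow> bool" where
  "symmetric T \<longleftrightarrow> (\<forall>\<alpha> \<beta>. \<forall>I\<in>\<S>.
     of_real \<alpha> + of_real \<beta> * I \<in> T \<longrightarrow> (\<forall>L\<in>\<S>. of_real \<alpha> + of_real \<beta> * L \<in> T))"

definition slice_holomorphic_on :: "quat \<Rightarrow> quat set \<Rightarrow> (quat \<Rightarrow> quat) \<Rightarrow> bool" where
  "slice_holomorphic_on I V g \<longleftrightarrow>
     openin (top_of_set (slice_plane I)) V \<and>
     (\<exists>g\<^sub>\<alpha> g\<^sub>\<beta>. continuous_on V g\<^sub>\<alpha> \<and> continuous_on V g\<^sub>\<beta> \<and>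
       (\<forall>\<alpha> \<beta>. of_real \<alpha> + of_real \<beta> * I \<in> V \<longrightarrow>
          ((\<lambda>a. g (of_real a + of_real \<beta> * I)) has_vector_derivative
              g\<^sub>\<alpha> (of_real \<alpha> + of_real \<beta> * I)) (at \<alpha>) \<and>
          ((\<lambda>b. g (of_real \<alpha> + of_real b * I)) has_vector_derivative
              g\<^sub>\<beta> (of_real \<alpha> + of_real \<beta> * I)) (at \<beta>) \<and>
          g\<^sub>\<alpha> (of_real \<alpha> + of_real \<beta> * I) + I * g\<^sub>\<beta> (of_real \<alpha> + of_real \<beta> * I) = 0))"

definition half_slice_holomorphic :: "quat \<Rightarrow> quat set \<Rightarrow> (quat \<Rightarrow> quat) \<Rightarrow> bool" where
  \<comment> \<open>Only the values of \<open>r\<close> on the half slice of \<open>T\<close> matter.\<close>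
  "half_slice_holomorphic I T r \<longleftrightarrow>
     (\<exists>V g. T \<inter> slice_half_plane I \<subseteq> V \<and> slice_holomorphic_on I V g \<and>
        (\<forall>q \<in> T \<inter> slice_half_plane I. r q = g q))"

definition slice_regular_on :: "quat set \<Rightarrow> (quat \<Rightarrow> quat) \<Rightarrow> bool" where
  "slice_regular_on \<Omega> f \<longleftrightarrow>
     open \<Omega> \<and> (\<forall>I\<in>\<S>. slice_holomorphic_on I (\<Omega> \<inter> slice_plane I) f)"

section \<open>Stem functions\<close>

text \<open>The pair \<open>(x, y)\<close> stands for the element \<open>x + \<iota>y\<close> of the complexified quaternions.\<close>

type_synonym cquat = "quat \<times> quat"

definition cquat_mult :: "cquat \<Rightarrow> cquat \<Rightarrow> cquat" where
  "cquat_mult p q = (fst p * fst q - snd p * snd q, fst p * snd q + snd p * fst q)"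

definition cquat_iota :: cquat where
  "cquat_iota = (0, 1)"

definition cquat_cnj :: "cquat \<Rightarrow> cquat" where
  "cquat_cnj p = (fst p, - snd p)"

definition circularization :: "complex set \<Rightarrow> quat set" where
  "circularization D = {\<phi> I z | z I. z \<in> D \<and> I \<in> \<S>}"

definition stem_function :: "complex set \<Rightarrow> (complex \<Rightarrow> cquat) \<Rightarrow> bool" where
  "stem_function D F \<longleftrightarrow> cnj ` D \<subseteq> D \<and> (\<forall>z\<in>D. F (cnj z) = cquat_cnj (F z))"

text \<open>Holomorphy is understood, as for functions on slices, in the \<open>C\<^sup>1\<close> sense: the
  real differential depends continuously on the point and intertwines the multiplications by
  \<open>\<iota>\<close> on domain and codomain.\<close>

definition holomorphic_stem_function :: "complex set \<Rightarrow> (complex \<Rightarrow> cquat) \<Rightarrow> bool" where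
  "holomorphic_stem_function D F \<longleftrightarrow> open D \<and> stem_function D F \<and>
     (\<exists>F'. (\<forall>z\<in>D. (F has_derivative F' z) (at z) \<and>
                  (\<forall>w. F' z (\<i> * w) = cquat_mult cquat_iota (F' z w))) \<and>
           (\<forall>w. continuous_on D (\<lambda>z. F' z w)))"

text \<open>A point of \<open>\<Omega>\<^sub>D\<close> has several representations \<open>\<alpha> + \<beta>I\<close>; for a stem function
  \<open>F\<close> they all give the same value, as lemma \<open>induced_eq\<close> shows.\<close>

definition induced :: "complex set \<Rightarrow> (complex \<Rightarrow> cquat) \<Rightarrow> quat \<Rightarrow> quat"  (\<open>\<I>\<close>) where
  "\<I> D F q = (THE w. \<exists>z\<in>D. \<exists>I\<in>\<S>. q = \<phi> I z \<and> w = fst (F z) + I * snd (F z))"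

definition SR :: "complex set \<Rightarrow> (quat \<Rightarrow> quat) set" where
  \<comment> \<open>The set of slice regular functions on \<open>\<Omega>\<^sub>D\<close>; functions are compared on \<open>\<Omega>\<^sub>D\<close> only.\<close>
  "SR D = {f. \<exists>F. holomorphic_stem_function D F \<and> (\<forall>q\<in>circularization D. f q = \<I> D F q)}"

text \<open>The functional description of the stem function glued from \<open>r\<close> and \<open>s\<close>: its values on the
  closed upper half of \<open>D\<close>, and its conjugation symmetry.\<close>

definition glued_stem ::
  "quat \<Rightarrow> quat \<Rightarrow> (quat \<Rightarrow> quat) \<Rightarrow> (quat \<Rightarrow> quat) \<Rightarrow> complex set \<Rightarrow> (complex \<Rightarrow> cquat) \<Rightarrow> bool" where
  "glued_stem J K r s D F \<longleftrightarrow> (\<forall>z\<in>D. Im z \<ge> 0 \<longrightarrow>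
      F z = (inverse (J - K) * (J * r (\<phi> J z) - K * s (\<phi> K z)),
             inverse (J - K) * (r (\<phi> J z) - s (\<phi> K z))) \<and>
      F (cnj z) = cquat_cnj (F z))"

lemma imag_units_iff:
  "I \<in> \<S> \<longleftrightarrow> qRe I = 0 \<and> (qI I)\<^sup>2 + (qJ I)\<^sup>2 + (qK I)\<^sup>2 = 1"
proof
  assume "I \<in> \<S>"
  then have sq: "I * I = - 1" by (simp add: imag_units_def power2_eq_square)
  have re: "qRe I * qRe I - qI I * qI I - qJ I * qJ I - qK I * qK I = - 1"
    using arg_cong[OF sq, of qRe] by simp
  have im: "2 * (qRe I * qI I) = 0" "2 * (qRe I * qJ I) = 0" "2 * (qRe I * qK I) = 0"
    using arg_cong[OF sq, of qI] arg_cong[OF sq, of qJ] arg_cong[OF sq, of qK]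
    by (simp_all add: algebra_simps)
  have "qRe I = 0"
  proof (rule ccontr)
    assume "qRe I \<noteq> 0"
    with im have "qI I = 0" "qJ I = 0" "qK I = 0" by auto
    with re have "qRe I * qRe I = - 1" by simp
    then show False using zero_le_square[of "qRe I"] by linarith
  qed
  with re show "qRe I = 0 \<and> (qI I)\<^sup>2 + (qJ I)\<^sup>2 + (qK I)\<^sup>2 = 1"
    by (simp add: power2_eq_square)
next
  assume "qRe I = 0 \<and> (qI I)\<^sup>2 + (qJ I)\<^sup>2 + (qK I)\<^sup>2 = 1"
  then show "I \<in> \<S>"
    by (simp add: imag_units_def quat_eq_iff power2_eq_square)
qed

lemma phi_sel:
  "qRe (\<phi> I z) = Re z + Im z * qRe I" "qI (\<phi> I z) = Im z * qI I"
  "qJ (\<phi> I z) = Im z * qJ I" "qK (\<phi> I z) = Im z * qK I"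
  by (simp_all add: phi_def of_real_def)

lemma phi_eq_cases:
  assumes "I \<in> \<S>" "L \<in> \<S>" "\<phi> I z = \<phi> L w"
  shows "(z = w \<and> (I = L \<or> Im z = 0)) \<or> (z = cnj w \<and> I = - L)"
proof -
  from assms have I: "qRe I = 0" "(qI I)\<^sup>2 + (qJ I)\<^sup>2 + (qK I)\<^sup>2 = 1"
    and L: "qRe L = 0" "(qI L)\<^sup>2 + (qJ L)\<^sup>2 + (qK L)\<^sup>2 = 1"
    by (simp_all add: imag_units_iff)
  from assms(3) I(1) L(1) have eq: "Re z = Re w" "Im z * qI I = Im w * qI L"
    "Im z * qJ I = Im w * qJ L" "Im z * qK I = Im w * qK L"
    by (simp_all add: quat_eq_iff phi_sel)
  have "(Im z)\<^sup>2 * ((qI I)\<^sup>2 + (qJ I)\<^sup>2 + (qK I)\<^sup>2) = (Im w)\<^sup>2 * ((qI L)\<^sup>2 + (qJ L)\<^sup>2 + (qK L)\<^sup>2)"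
    using eq by (simp add: distrib_left power_mult_distrib[symmetric])
  with I L have "(Im z)\<^sup>2 = (Im w)\<^sup>2" by simp
  then consider "Im z = Im w" | "Im z = - Im w" "Im z \<noteq> Im w" unfolding power2_eq_iff by blast
  then show ?thesis
  proof cases
    case 1
    with eq I L show ?thesis by (auto simp: complex_eq_iff quat_eq_iff)
  next
    case 2
    then have "Im w \<noteq> 0" by auto
    have *: "a = - b" if "Im z * a = Im w * b" for a b
    proof -
      have "Im w * (a + b) = 0" using that 2(1) by (simp add: algebra_simps)
      with \<open>Im w \<noteq> 0\<close> show ?thesis by simp
    qed
    have "qI I = - qI L" "qJ I = - qJ L" "qK I = - qK L"
      using eq by (auto intro!: *)
    with 2 eq I L show ?thesis by (auto simp: complex_eq_iff quat_eq_iff)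
  qed
qed

lemma induced_eq:
  assumes F: "stem_function D F" and z: "z \<in> D" and I: "I \<in> \<S>"
  shows "\<I> D F (\<phi> I z) = fst (F z) + I * snd (F z)"
  unfolding induced_def
proof (rule the_equality)
  show "\<exists>w\<in>D. \<exists>L\<in>\<S>. \<phi> I z = \<phi> L w \<and> fst (F z) + I * snd (F z) = fst (F w) + L * snd (F w)"
    using z I by blast
next
  fix v
  assume "\<exists>w\<in>D. \<exists>L\<in>\<S>. \<phi> I z = \<phi> L w \<and> v = fst (F w) + L * snd (F w)"
  then obtain w L where w: "w \<in> D" and L: "L \<in> \<S>" and eq: "\<phi> I z = \<phi> L w"
    and v: "v = fst (F w) + L * snd (F w)" by blast
  have real: "snd (F z) = 0" if "Im z = 0"
  proof -
    from that have "cnj z = z" by (simp add: complex_eq_iff)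
    moreover have "F (cnj z) = cquat_cnj (F z)" using F z by (simp add: stem_function_def)
    ultimately have "snd (F z) = - snd (F z)"
      by (metis cquat_cnj_def snd_conv)
    then show ?thesis by (simp add: quat_eq_iff)
  qed
  from phi_eq_cases[OF I L eq] show "v = fst (F z) + I * snd (F z)"
  proof
    assume "z = w \<and> (I = L \<or> Im z = 0)"
    with real v show ?thesis by auto
  next
    assume *: "z = cnj w \<and> I = - L"
    then have "F z = cquat_cnj (F w)" using F w by (auto simp: stem_function_def)
    with * v show ?thesis by (simp add: cquat_cnj_def)
  qed
qed

end

theory Submission
  imports Defs
begin

text \<open>On the closed upper half of \<open>D\<close> the values \<open>(x, y)\<close> of the stem function are forced by
  \<open>x + J y = r\<close> and \<open>x + K y = s\<close>. The solution of this system turns left multiplication of \<open>r\<close>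
  by \<open>J\<close> and of \<open>s\<close> by \<open>K\<close> into multiplication by \<open>\<iota>\<close>, so the Cauchy--Riemann equations of \<open>r\<close>
  and \<open>s\<close> become those of the stem function. The hypothesis \<open>r = s\<close> on the real axis says that
  the stem function is real there, and the Schwarz reflection principle gives holomorphy
  across the axis.\<close>

section \<open>Slices parametrized by the maps \<open>\<phi> I\<close>\<close>

lemma phi_eq_scaleR: "\<phi> I z = Re z *\<^sub>R 1 + Im z *\<^sub>R I"
  by (simp add: quat_eq_iff phi_sel)

lemma bounded_linear_phi: "bounded_linear (\<phi> I)"
  unfolding phi_eq_scaleR
  by (intro bounded_linear_add bounded_linear_scaleR_const bounded_linear_Re bounded_linear_Im)

lemma open_vimage_phi: "open T \<Longrightarrow> open (\<phi> I -` T)"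
  by (rule open_vimage[OF _ linear_continuous_on[OF bounded_linear_phi]])

lemma imag_unit_mult_self:
  assumes "I \<in> \<S>"
  shows "I * I = - 1"
  using assms by (simp add: imag_units_def power2_eq_square)

lemma imag_unit_mult_mult_self:
  assumes "I \<in> \<S>"
  shows "I * (I * x) = - x"
  using imag_unit_mult_self[OF assms] by (simp flip: mult.assoc)

lemma uminus_imag_unit: "I \<in> \<S> \<Longrightarrow> - I \<in> \<S>"
  by (simp add: imag_units_def)

lemma phi_cnj: "\<phi> I (cnj z) = \<phi> (- I) z"
  by (simp add: phi_eq_scaleR)

lemma slice_plane_eq_range_phi: "slice_plane I = range (\<phi> I)"
proof
  show "slice_plane I \<subseteq> range (\<phi> I)"
  proof
    fix q assume "q \<in> slice_plane I"
    then obtain a b where "q = \<phi> I (Complex a b)"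
      by (auto simp: slice_plane_def phi_def)
    then show "q \<in> range (\<phi> I)" by blast
  qed
qed (auto simp: slice_plane_def phi_def)

lemma slice_half_plane_eq_image_phi: "slice_half_plane I = \<phi> I ` {z. Im z \<ge> 0}"
proof
  show "slice_half_plane I \<subseteq> \<phi> I ` {z. Im z \<ge> 0}"
  proof
    fix q assume "q \<in> slice_half_plane I"
    then obtain a b where "q = \<phi> I (Complex a b)" "b \<ge> 0"
      by (auto simp: slice_half_plane_def phi_def)
    then show "q \<in> \<phi> I ` {z. Im z \<ge> 0}" by force
  qed
qed (auto simp: slice_half_plane_def phi_def)

text \<open>Normalizing the imaginary part gives the unit. A real quaternion lies in every slice
  plane, so an arbitrary unit serves in that case. This is what shows that the slices exhaust
  \<open>\<Omega>\<close>.\<close>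

lemma quat_in_slice_plane:
  obtains I where "I \<in> \<S>" "q \<in> slice_plane I"
proof -
  define v where "v = Quat 0 (qI q) (qJ q) (qK q)"
  have q: "q = qRe q *\<^sub>R 1 + v" by (simp add: v_def quat_eq_iff)
  show ?thesis
  proof (cases "v = 0")
    case True
    have "Quat 0 1 0 0 \<in> \<S>" by (simp add: imag_units_iff)
    moreover have "q = \<phi> (Quat 0 1 0 0) (Complex (qRe q) 0)"
      using q True by (simp add: phi_eq_scaleR)
    ultimately show ?thesis
      using that slice_plane_eq_range_phi by blast
  next
    case False
    have v: "qRe v = 0" "(qI v)\<^sup>2 + (qJ v)\<^sup>2 + (qK v)\<^sup>2 = (norm v)\<^sup>2"
      by (simp_all add: norm_quat_def v_def)
    have "(inverse (norm v))\<^sup>2 * ((qI v)\<^sup>2 + (qJ v)\<^sup>2 + (qK v)\<^sup>2) = 1"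
      unfolding v(2) using False by (simp flip: power_mult_distrib)
    then have "v /\<^sub>R norm v \<in> \<S>"
      unfolding imag_units_iff by (simp add: v(1) power_mult_distrib distrib_left)
    moreover have "q = \<phi> (v /\<^sub>R norm v) (Complex (qRe q) (norm v))"
      using q False by (simp add: phi_eq_scaleR)
    ultimately show ?thesis
      using that slice_plane_eq_range_phi by blast
  qed
qed

lemma symmetric_phi:
  assumes "symmetric T" "I \<in> \<S>" "L \<in> \<S>"
  shows "\<phi> I z \<in> T \<longleftrightarrow> \<phi> L z \<in> T"
  using assms unfolding symmetric_def phi_def by blast

section \<open>Slice holomorphy in the complex coordinate\<close>

lemma slice_holomorphic_on_open_vimage:
  assumes "slice_holomorphic_on I V g"
  shows "open (\<phi> I -` V)"
proof -
  obtain T where "open T" "V = slice_plane I \<inter> T"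
    using assms unfolding slice_holomorphic_on_def openin_open by blast
  then have "\<phi> I -` V = \<phi> I -` T" by (auto simp: slice_plane_eq_range_phi)
  with \<open>open T\<close> show ?thesis by (simp add: open_vimage_phi)
qed

text \<open>A partial derivative in \<alpha> and a continuous partial derivative in \<beta> yield a
  total derivative. The Cauchy-Riemann equation, multiplied on the left by \<open>I\<close>,
  expresses the second partial as \<open>I\<close> times the first, so multiplication by
  \<open>\<i>\<close> on the domain corresponds to left multiplication by \<open>I\<close> on the
  values.\<close>

lemma slice_holomorphic_on_has_derivative:
  assumes g: "slice_holomorphic_on I V g" and I: "I \<in> \<S>" and z: "\<phi> I z \<in> V"
  shows "\<exists>A. ((\<lambda>w. g (\<phi> I w)) has_derivative (\<lambda>w. Re w *\<^sub>R A + Im w *\<^sub>R (I * A))) (at z)"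
proof -
  obtain ga gb where contb: "continuous_on V gb"
    and dera: "\<And>a b. of_real a + of_real b * I \<in> V \<Longrightarrow>
      ((\<lambda>a. g (of_real a + of_real b * I)) has_vector_derivative ga (of_real a + of_real b * I)) (at a)"
    and derb: "\<And>a b. of_real a + of_real b * I \<in> V \<Longrightarrow>
      ((\<lambda>b. g (of_real a + of_real b * I)) has_vector_derivative gb (of_real a + of_real b * I)) (at b)"
    and CR: "\<And>a b. of_real a + of_real b * I \<in> V \<Longrightarrow>
      ga (of_real a + of_real b * I) + I * gb (of_real a + of_real b * I) = 0"
    using g unfolding slice_holomorphic_on_def by blast
  let ?p = "\<lambda>a b. of_real a + of_real b * I"
  have op: "open ((\<lambda>(a, b). Complex a b) -` (\<phi> I -` V))"
    by (rule open_vimage[OF slice_holomorphic_on_open_vimage[OF g]])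
       (auto simp: case_prod_unfold intro!: continuous_intros)
  have "(Re z, Im z) \<in> (\<lambda>(a, b). Complex a b) -` (\<phi> I -` V)"
    using z by simp
  then obtain X Y0 where "open X" "open Y0" "(Re z, Im z) \<in> X \<times> Y0"
    and sub0: "X \<times> Y0 \<subseteq> (\<lambda>(a, b). Complex a b) -` (\<phi> I -` V)"
    by (rule open_prod_elim[OF op])
  then have X: "open X" "Re z \<in> X" and Y0: "open Y0" "Im z \<in> Y0" by auto
  \<comment> \<open>The second factor is shrunk to a ball because the criterion for total
    differentiability applied below asks for convexity in that variable.\<close>
  obtain e where e: "e > 0" "ball (Im z) e \<subseteq> Y0"
    using Y0 open_contains_ball by blast
  define Y where "Y = ball (Im z) e"
  have Y: "open Y" "Im z \<in> Y" "convex Y" using e by (auto simp: Y_def)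
  have sub: "?p a b \<in> V" if "a \<in> X" "b \<in> Y" for a b
  proof -
    have "(a, b) \<in> X \<times> Y0" using that e by (auto simp: Y_def)
    with sub0 show ?thesis by (auto simp: phi_def)
  qed
  have cont2: "continuous_on (X \<times> Y) (\<lambda>u. gb (?p (fst u) (snd u)))"
    by (rule continuous_on_compose2[OF contb]) (auto intro!: continuous_intros sub)
  have "((\<lambda>(a, b). g (?p a b)) has_derivative
      (\<lambda>(s, t). s *\<^sub>R ga (?p (Re z) (Im z)) + blinfun_apply (blinfun_scaleR_left (gb (?p (Re z) (Im z)))) t))
      (at (Re z, Im z) within X \<times> Y)"
  proof (rule has_derivative_partialsI[where fy = "\<lambda>a b. blinfun_scaleR_left (gb (?p a b))"])
    show "((\<lambda>a. g (?p a (Im z))) has_derivative (\<lambda>s. s *\<^sub>R ga (?p (Re z) (Im z)))) (at (Re z) within X)"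
      using dera[OF sub[OF X(2) Y(2)]]
      by (auto simp: has_vector_derivative_def intro: has_derivative_at_withinI)
    show "((\<lambda>b. g (?p a b)) has_derivative blinfun_apply (blinfun_scaleR_left (gb (?p a b))))
        (at b within Y)" if "a \<in> X" "b \<in> Y" for a b
      using derb[OF sub[OF that]]
      by (auto simp: has_vector_derivative_def intro: has_derivative_at_withinI)
    have "continuous_on (X \<times> Y) (\<lambda>u. blinfun_scaleR_left (gb (?p (fst u) (snd u))))"
      by (intro bounded_linear.continuous_on[OF bounded_linear_blinfun_scaleR_left] cont2)
    then show "continuous (at (Re z, Im z) within X \<times> Y) (\<lambda>(a, b). blinfun_scaleR_left (gb (?p a b)))"
      using X Y by (simp add: continuous_on_eq_continuous_within case_prod_unfold)
  qed (use Y in auto)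
  moreover have "at (Re z, Im z) within X \<times> Y = at (Re z, Im z)"
    by (rule at_within_open) (use X Y in \<open>auto intro: open_Times\<close>)
  ultimately have "((\<lambda>u. g (?p (fst u) (snd u))) has_derivative
      (\<lambda>u. fst u *\<^sub>R ga (\<phi> I z) + snd u *\<^sub>R gb (\<phi> I z))) (at (Re z, Im z))"
    by (simp add: case_prod_unfold phi_def)
  moreover have "((\<lambda>w. (Re w, Im w)) has_derivative (\<lambda>w. (Re w, Im w))) (at z)"
    by (intro bounded_linear_imp_has_derivative bounded_linear_Pair bounded_linear_Re bounded_linear_Im)
  ultimately have "((\<lambda>w. g (?p (fst (Re w, Im w)) (snd (Re w, Im w)))) has_derivative
      (\<lambda>w. fst (Re w, Im w) *\<^sub>R ga (\<phi> I z) + snd (Re w, Im w) *\<^sub>R gb (\<phi> I z))) (at z)"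
    using has_derivative_compose by fast
  then have "((\<lambda>w. g (\<phi> I w)) has_derivative
      (\<lambda>w. Re w *\<^sub>R ga (\<phi> I z) + Im w *\<^sub>R gb (\<phi> I z))) (at z)"
    by (simp add: phi_def)
  moreover have "gb (\<phi> I z) = I * ga (\<phi> I z)"
  proof -
    have "ga (\<phi> I z) = - (I * gb (\<phi> I z))"
      using CR[of "Re z" "Im z"] z by (simp add: phi_def eq_neg_iff_add_eq_0)
    then show ?thesis by (simp add: imag_unit_mult_mult_self[OF I])
  qed
  ultimately show ?thesis by metis
qed

section \<open>Stem functions through complex coordinates, and Schwarz reflection\<close>

lemma cquat_mult_iota: "cquat_mult cquat_iota p = (- snd p, fst p)"
  by (simp add: cquat_mult_def cquat_iota_def)

text \<open>A real linear map that intertwines \<open>\<i>\<close> with \<iota> is determined by its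
  value at \<open>1\<close>. In each coordinate pair it is therefore multiplication by a single
  complex number.\<close>

lemma cquat_inner_has_field_derivative:
  fixes F :: "complex \<Rightarrow> cquat" and b :: quat
  assumes F: "(F has_derivative F') (at z)"
    and iota: "\<And>w. F' (\<i> * w) = cquat_mult cquat_iota (F' w)"
  shows "((\<lambda>z. Complex (inner (fst (F z)) b) (inner (snd (F z)) b)) has_field_derivative
      Complex (inner (fst (F' 1)) b) (inner (snd (F' 1)) b)) (at z)"
proof -
  have lin: "bounded_linear (\<lambda>p. Complex (inner (fst p) b) (inner (snd p) b))"
    for b :: quat unfolding Complex_eq
    by (intro bounded_linear_add bounded_linear_const_mult bounded_linear_of_real
        bounded_linear_compose[OF bounded_linear_of_real]
        bounded_linear_compose[OF bounded_linear_inner_left] bounded_linear_fst bounded_linear_snd)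
  interpret F': bounded_linear F' using F by (rule has_derivative_bounded_linear)
  have "F' w = Re w *\<^sub>R F' 1 + Im w *\<^sub>R cquat_mult cquat_iota (F' 1)" for w
  proof -
    have "F' w = F' (Re w *\<^sub>R 1 + Im w *\<^sub>R (\<i> * 1))"
      by (rule arg_cong[where f = F']) (simp add: complex_eq_iff)
    then show ?thesis unfolding F'.add F'.scaleR iota .
  qed
  then have F'_eq: "fst (F' w) = Re w *\<^sub>R fst (F' 1) - Im w *\<^sub>R snd (F' 1)"
    "snd (F' w) = Re w *\<^sub>R snd (F' 1) + Im w *\<^sub>R fst (F' 1)" for w
    by (metis (no_types, lifting) cquat_mult_iota fst_add fst_scaleR fst_conv scaleR_minus_right
        add_uminus_conv_diff, metis (no_types, lifting) cquat_mult_iota snd_add snd_scaleR snd_conv)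
  have "Complex (inner (fst (F' w)) b) (inner (snd (F' w)) b) =
      Complex (inner (fst (F' 1)) b) (inner (snd (F' 1)) b) * w" for w
    by (simp add: F'_eq[of w] complex_eq_iff inner_left_distrib inner_diff_left)
  then have "(\<lambda>w. Complex (inner (fst (F' w)) b) (inner (snd (F' w)) b)) =
      (*) (Complex (inner (fst (F' 1)) b) (inner (snd (F' 1)) b))" by (rule ext)
  then show ?thesis
    using bounded_linear.has_derivative[OF lin[of b] F] unfolding has_field_derivative_def
    by (simp only:)
qed

text \<open>Converse passage from coordinates to the stem function. Continuity of the differential
  comes for free, since the derivative of a holomorphic function is again holomorphic.\<close>

lemma holomorphic_stem_functionI:
  assumes D: "open D" and stem: "stem_function D F"
    and hol: "\<And>b. b \<in> Basis \<Longrightarrow>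
      (\<lambda>z. Complex (inner (fst (F z)) b) (inner (snd (F z)) b)) holomorphic_on D"
  shows "holomorphic_stem_function D F"
proof -
  define h where "h b z = Complex (inner (fst (F z)) b) (inner (snd (F z)) b)" for b z
  \<comment> \<open>The candidate differential multiplies \<open>w\<close> by the complex derivative
    in each coordinate and reassembles real and imaginary parts along the basis.\<close>
  define F' where "F' z w = (\<Sum>b\<in>Basis. Re (deriv (h b) z * w) *\<^sub>R b,
      \<Sum>b\<in>Basis. Im (deriv (h b) z * w) *\<^sub>R b)" for z w
  have hol': "h b holomorphic_on D" if "b \<in> Basis" for b
    using hol[OF that] by (simp add: h_def[abs_def])
  have "(F has_derivative F' z) (at z)" if z: "z \<in> D" for z
  proof -
    have h: "(h b has_derivative (\<lambda>w. deriv (h b) z * w)) (at z)" if "b \<in> Basis" for b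
      using holomorphic_derivI[OF hol'[OF that] D z] by (simp add: has_field_derivative_def)
    have "((\<lambda>z. fst (F z)) has_derivative (\<lambda>w. fst (F' z w))) (at z)"
    proof (subst has_derivative_componentwise_within, intro ballI)
      fix b :: quat assume b: "b \<in> Basis"
      show "((\<lambda>z. inner (fst (F z)) b) has_derivative (\<lambda>w. inner (fst (F' z w)) b)) (at z)"
        using bounded_linear.has_derivative[OF bounded_linear_Re h[OF b]] b
        by (simp add: F'_def h_def)
    qed
    moreover have "((\<lambda>z. snd (F z)) has_derivative (\<lambda>w. snd (F' z w))) (at z)"
    proof (subst has_derivative_componentwise_within, intro ballI)
      fix b :: quat assume b: "b \<in> Basis"
      show "((\<lambda>z. inner (snd (F z)) b) has_derivative (\<lambda>w. inner (snd (F' z w)) b)) (at z)"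
        using bounded_linear.has_derivative[OF bounded_linear_Im h[OF b]] b
        by (simp add: F'_def h_def)
    qed
    ultimately show ?thesis
      using has_derivative_Pair by fastforce
  qed
  moreover have "F' z (\<i> * w) = cquat_mult cquat_iota (F' z w)" for z w
  proof -
    have "Re (deriv (h b) z * (\<i> * w)) = - Im (deriv (h b) z * w)"
      "Im (deriv (h b) z * (\<i> * w)) = Re (deriv (h b) z * w)" for b by simp_all
    then show ?thesis
      unfolding F'_def cquat_mult_iota by (simp only: fst_conv snd_conv scaleR_minus_left sum_negf)
  qed
  moreover have "continuous_on D (\<lambda>z. F' z w)" for w
    unfolding F'_def
    by (intro continuous_intros holomorphic_on_imp_continuous_on holomorphic_deriv hol' D)
  ultimately show ?thesis
    using D stem unfolding holomorphic_stem_function_def by blast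
qed

text \<open>The complexified quaternions form a complex vector space on which \<open>cquat_cnj\<close> acts as
  complex conjugation in each of four coordinates, so the Schwarz reflection principle applies
  coordinatewise. The values on the real axis are automatically real there, by the symmetry
  \<open>F (cnj z) = cquat_cnj (F z)\<close>.\<close>

lemma stem_Schwarz_reflection:
  assumes D: "open D" and stem: "stem_function D F"
    and cont: "continuous_on (D \<inter> {z. 0 \<le> Im z}) F"
    and der: "\<And>z. z \<in> D \<Longrightarrow> 0 < Im z \<Longrightarrow>
      \<exists>F'. (F has_derivative F') (at z) \<and> (\<forall>w. F' (\<i> * w) = cquat_mult cquat_iota (F' w))"
  shows "holomorphic_stem_function D F"
proof (rule holomorphic_stem_functionI[OF D stem])
  fix b :: quat
  let ?h = "\<lambda>z. Complex (inner (fst (F z)) b) (inner (snd (F z)) b)"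
  have h_cnj: "?h (cnj z) = cnj (?h z)" if "z \<in> D" for z
    using stem that by (auto simp: stem_function_def cquat_cnj_def complex_eq_iff)
  have cnjD: "cnj ` D \<subseteq> D" using stem by (simp add: stem_function_def)
  \<comment> \<open>Conjugation symmetry makes this reflected function equal to \<open>?h\<close> on
    all of \<open>D\<close>, so reflection produces no new function but proves \<open>?h\<close>
    holomorphic.\<close>
  have "(\<lambda>z. if 0 \<le> Im z then ?h z else cnj (?h (cnj z))) holomorphic_on D"
  proof (rule Schwarz_reflection[OF D cnjD])
    show "?h holomorphic_on D \<inter> {z. 0 < Im z}"
    proof (rule holomorphic_on_subset[of _ "{z \<in> D. 0 < Im z}"])
      have "?h field_differentiable (at z)" if "z \<in> D" "0 < Im z" for z
        using der[OF that] cquat_inner_has_field_derivative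
        unfolding field_differentiable_def by blast
      then show "?h holomorphic_on {z \<in> D. 0 < Im z}"
        by (auto simp: holomorphic_on_def intro: field_differentiable_at_within)
    qed auto
    show "continuous_on (D \<inter> {z. 0 \<le> Im z}) ?h"
      by (intro continuous_intros cont)
    show "?h z \<in> \<real>" if "z \<in> D" "z \<in> \<real>" for z
      using h_cnj[OF that(1)] that(2) by (simp add: Reals_cnj_iff)
  qed
  then show "?h holomorphic_on D"
  proof (rule holomorphic_transform)
    show "(if 0 \<le> Im z then ?h z else cnj (?h (cnj z))) = ?h z" if "z \<in> D" for z
      unfolding h_cnj[OF that] complex_cnj_cnj by (rule if_cancel)
  qed
qed

section \<open>Slice regularity of induced functions\<close>

text \<open>A point of the slice plane of \<open>I\<close> may arise from another unit, but then the
  two complex coordinates agree or are conjugate, and conjugation preserves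
  \<open>D\<close>.\<close>

lemma circularization_Int_slice_plane:
  assumes "cnj ` D \<subseteq> D" "I \<in> \<S>"
  shows "circularization D \<inter> slice_plane I = \<phi> I ` D"
proof
  show "circularization D \<inter> slice_plane I \<subseteq> \<phi> I ` D"
  proof
    fix q assume "q \<in> circularization D \<inter> slice_plane I"
    then obtain z L w where "z \<in> D" "L \<in> \<S>" "q = \<phi> L z" "q = \<phi> I w"
      by (auto simp: circularization_def slice_plane_eq_range_phi)
    with phi_eq_cases[of I L w z] assms have "w \<in> D" by auto
    with \<open>q = \<phi> I w\<close> show "q \<in> \<phi> I ` D" by simp
  qed
qed (use assms in \<open>auto simp: circularization_def slice_plane_eq_range_phi\<close>)

text \<open>\<open>1\<close> and \<open>I\<close> are orthonormal, so inner products with them give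
  a continuous left inverse of \<open>\<phi> I\<close>.\<close>

lemma phi_inverse:
  assumes "I \<in> \<S>"
  shows "Complex (inner 1 (\<phi> I z)) (inner I (\<phi> I z)) = z"
proof -
  have re: "qRe I = 0" using assms by (simp add: imag_units_iff)
  have "inner I (\<phi> I z) = Im z * ((qI I)\<^sup>2 + (qJ I)\<^sup>2 + (qK I)\<^sup>2)"
    using re by (simp add: inner_quat_def phi_sel power2_eq_square algebra_simps)
  also have "\<dots> = Im z" using assms by (simp add: imag_units_iff)
  finally show ?thesis
    using assms by (simp add: complex_eq_iff imag_units_iff inner_quat_def[of 1] phi_sel)
qed

text \<open>The map sending \<open>(x, y)\<close> to \<open>x + I * y\<close> turns multiplication
  by \<iota> into left multiplication by \<open>I\<close>. Composed with the differential of
  \<open>F\<close> it gives partial derivatives \<open>A\<close> and \<open>I * A\<close>, and these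
  satisfy the Cauchy-Riemann equation because \<open>I\<close> squares to \<open>-1\<close>.\<close>

lemma induced_slice_regular:
  assumes F: "holomorphic_stem_function D F" and op: "open (circularization D)"
  shows "slice_regular_on (circularization D) (\<I> D F)"
  unfolding slice_regular_on_def
proof (intro conjI op ballI)
  fix I assume I: "I \<in> \<S>"
  obtain F' where F': "\<And>z. z \<in> D \<Longrightarrow> (F has_derivative F' z) (at z)"
    and iota: "\<And>z w. z \<in> D \<Longrightarrow> F' z (\<i> * w) = cquat_mult cquat_iota (F' z w)"
    and cont: "\<And>w. continuous_on D (\<lambda>z. F' z w)"
    and D: "open D" and stem: "stem_function D F"
    using F unfolding holomorphic_stem_function_def by blast
  have cnjD: "cnj ` D \<subseteq> D" using stem by (simp add: stem_function_def)
  \<comment> \<open>The \<alpha>-derivative as a function of the quaternion \<open>q\<close>, whose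
    complex coordinate is recovered by inner products.\<close>
  define A where "A q = (let w = F' (Complex (inner 1 q) (inner I q)) 1 in fst w + I * snd w)" for q
  have A_phi: "A (\<phi> I z) = fst (F' z 1) + I * snd (F' z 1)" for z
    using I by (simp add: A_def phi_inverse Let_def)
  let ?V = "circularization D \<inter> slice_plane I"
  note V = circularization_Int_slice_plane[OF cnjD I]
  have contA: "continuous_on ?V A"
    unfolding A_def Let_def
    by (intro continuous_intros continuous_on_compose2[OF cont])
       (auto simp: V phi_inverse[OF I] intro!: continuous_intros)
  \<comment> \<open>Differentiation along a general path \<open>p\<close> covers both partial
    derivatives at once: \<open>p\<close> will be a horizontal or a vertical line.\<close>
  have der: "((\<lambda>t. \<I> D F (\<phi> I (p t))) has_vector_derivative
      fst (F' z v) + I * snd (F' z v)) (at x)"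
    if z: "z \<in> D" "p x = z" and p: "(p has_vector_derivative v) (at x)"
      and contp: "continuous_on UNIV p" for p z x v
  proof -
    have "(F has_derivative F' z) (at (p x))" using F' z by simp
    from diff_chain_at[OF p[unfolded has_vector_derivative_def] this]
    have "((\<lambda>t. F (p t)) has_derivative (\<lambda>h. F' z (h *\<^sub>R v))) (at x)"
      by (simp add: o_def)
    then have "((\<lambda>t. F (p t)) has_vector_derivative F' z v) (at x)"
      using has_derivative_bounded_linear[OF F'[OF z(1)]]
      by (simp add: has_vector_derivative_def linear_simps)
    moreover have "bounded_linear (\<lambda>u :: cquat. fst u + I * snd u)"
      by (intro bounded_linear_intros)
    ultimately have "((\<lambda>t. fst (F (p t)) + I * snd (F (p t))) has_vector_derivative
        fst (F' z v) + I * snd (F' z v)) (at x)"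
      using bounded_linear.has_vector_derivative by fastforce
    \<comment> \<open>The formula for the induced function is available only while the path stays in
      \<open>D\<close>, which it does near \<open>x\<close>.\<close>
    moreover have "open (p -` D)" by (rule open_vimage[OF D contp])
    ultimately show ?thesis
      by (rule has_vector_derivative_transform_within_open) (use z in \<open>auto simp: induced_eq[OF stem _ I]\<close>)
  qed
  show "slice_holomorphic_on I ?V (\<I> D F)"
    unfolding slice_holomorphic_on_def
  proof (intro conjI exI allI impI)
    show "openin (top_of_set (slice_plane I)) ?V"
      using openin_open_Int[OF op, of "slice_plane I"] by (simp add: Int_commute)
    show "continuous_on ?V A" by (rule contA)
    show "continuous_on ?V (\<lambda>q. I * A q)" by (intro continuous_intros contA)
    fix a b :: real
    assume "of_real a + of_real b * I \<in> ?V"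
    then have "\<phi> I (Complex a b) \<in> ?V" by (simp add: phi_def)
    then obtain w where w: "w \<in> D" "\<phi> I (Complex a b) = \<phi> I w" unfolding V by blast
    have z: "Complex a b \<in> D"
      using w phi_inverse[OF I, of w] phi_inverse[OF I, of "Complex a b"] by simp
    have "((\<lambda>a. Complex a b) has_vector_derivative 1) (at a)"
      unfolding Complex_eq by (auto intro!: derivative_eq_intros)
    from der[OF z refl this continuous_on_Complex[OF continuous_on_id continuous_on_const]]
    show "((\<lambda>a. \<I> D F (of_real a + of_real b * I)) has_vector_derivative
        A (of_real a + of_real b * I)) (at a)"
      using A_phi[of "Complex a b"] by (simp add: phi_def)
    have "((\<lambda>b. Complex a b) has_vector_derivative \<i>) (at b)"
      unfolding Complex_eq by (auto intro!: derivative_eq_intros)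
    from der[OF z refl this continuous_on_Complex[OF continuous_on_const continuous_on_id]]
    have "((\<lambda>b. \<I> D F (\<phi> I (Complex a b))) has_vector_derivative
        - snd (F' (Complex a b) 1) + I * fst (F' (Complex a b) 1)) (at b)"
      using iota[OF z, of 1] by (simp add: cquat_mult_iota)
    then show "((\<lambda>b. \<I> D F (of_real a + of_real b * I)) has_vector_derivative
        I * A (of_real a + of_real b * I)) (at b)"
      using A_phi[of "Complex a b"]
      by (simp add: phi_def distrib_left imag_unit_mult_mult_self[OF I])
    show "A (of_real a + of_real b * I) + I * (I * A (of_real a + of_real b * I)) = 0"
      by (simp add: imag_unit_mult_mult_self[OF I])
  qed
qed

section \<open>The linear system attached to two imaginary units\<close>

text \<open>Both units square to \<open>-1\<close>, so \<open>(J - K) * J\<close> and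
  \<open>- (K * (J - K))\<close> both equal \<open>- 1 - K * J\<close>. Multiplying by the inverse
  of \<open>J - K\<close> on each side gives the rule, which replaces the missing
  commutativity.\<close>

lemma imag_units_inverse_diff_commute:
  assumes "J \<in> \<S>" "K \<in> \<S>" "J \<noteq> K"
  shows "J * inverse (J - K) = - (inverse (J - K) * K)"
proof -
  let ?d = "J - K"
  have nz: "?d \<noteq> 0" using assms by simp
  have "?d * J = - (K * ?d)"
    using assms by (simp add: algebra_simps imag_unit_mult_self)
  then have "inverse ?d * (?d * J) * inverse ?d = - (inverse ?d * K * (?d * inverse ?d))"
    by (simp add: mult.assoc)
  with nz show ?thesis by (simp flip: mult.assoc)
qed

text \<open>The solution \<open>(x, y)\<close> of \<open>x + J * y = a\<close> and
  \<open>x + K * y = b\<close>: subtraction gives \<open>y\<close>, and the rule for moving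
  \<open>J\<close> past the inverse brings \<open>x = a - J * y\<close> to the form shown.
  Separating it from \<open>r\<close> and \<open>s\<close> exposes its linearity in
  \<open>(a, b)\<close>.\<close>

definition glue_values :: "quat \<Rightarrow> quat \<Rightarrow> quat \<Rightarrow> quat \<Rightarrow> cquat" where
  "glue_values J K a b = (inverse (J - K) * (J * a - K * b), inverse (J - K) * (a - b))"

lemma glue_values_solves:
  assumes "J \<in> \<S>" "K \<in> \<S>" "J \<noteq> K"
  shows "fst (glue_values J K a b) + J * snd (glue_values J K a b) = a"
    and "fst (glue_values J K a b) + K * snd (glue_values J K a b) = b"
proof -
  let ?c = "inverse (J - K)"
  have c: "?c * (J - K) = 1" using assms by simp
  have J: "J * ?c = - (?c * K)" by (rule imag_units_inverse_diff_commute[OF assms])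
  \<comment> \<open>The same rule with \<open>J\<close> and \<open>K\<close> exchanged; the sign
    from \<open>K - J\<close> occurs on both sides and cancels.\<close>
  have K: "K * ?c = - (?c * J)"
    using imag_units_inverse_diff_commute[of K J] assms
    by (metis inverse_minus_eq minus_diff_eq mult_minus_left mult_minus_right)
  have "?c * (J * a - K * b) + J * (?c * (a - b)) = ?c * (J - K) * a"
    by (simp add: mult.assoc[of J, symmetric] J) (simp add: algebra_simps)
  with c show "fst (glue_values J K a b) + J * snd (glue_values J K a b) = a"
    by (simp add: glue_values_def)
  have "?c * (J * a - K * b) + K * (?c * (a - b)) = ?c * (J - K) * b"
    by (simp add: mult.assoc[of K, symmetric] K) (simp add: algebra_simps)
  with c show "fst (glue_values J K a b) + K * snd (glue_values J K a b) = b"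
    by (simp add: glue_values_def)
qed

lemma bounded_linear_glue_values:
  "bounded_linear (\<lambda>p. glue_values J K (fst p) (snd p))"
  unfolding glue_values_def
  by (intro bounded_linear_Pair bounded_linear_intros)

text \<open>Left multiplication of the data by \<open>J\<close> and \<open>K\<close> swaps the
  differences \<open>J * a - K * b\<close> and \<open>a - b\<close>, up to the sign coming from the
  squares.\<close>

lemma glue_values_iota:
  assumes "J \<in> \<S>" "K \<in> \<S>"
  shows "glue_values J K (J * a) (K * b) = cquat_mult cquat_iota (glue_values J K a b)"
  using assms
  by (simp add: glue_values_def cquat_mult_iota imag_unit_mult_mult_self algebra_simps)

section \<open>Existence and uniqueness of the glued stem function\<close>

lemma glued_stem_iff:
  "glued_stem J K r s D F \<longleftrightarrow> (\<forall>z\<in>D. Im z \<ge> 0 \<longrightarrow>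
     F z = glue_values J K (r (\<phi> J z)) (s (\<phi> K z)) \<and> F (cnj z) = cquat_cnj (F z))"
  by (simp add: glued_stem_def glue_values_def)

lemma cquat_cnj_cnj: "cquat_cnj (cquat_cnj p) = p"
  by (simp add: cquat_cnj_def)

lemma glued_stem_stem_function:
  assumes cnjD: "cnj ` D \<subseteq> D" and F: "glued_stem J K r s D F"
  shows "stem_function D F"
  unfolding stem_function_def
proof (intro conjI cnjD ballI)
  fix z assume z: "z \<in> D"
  show "F (cnj z) = cquat_cnj (F z)"
  proof (cases "Im z \<ge> 0")
    case True
    with F z show ?thesis by (simp add: glued_stem_def)
  next
    case False
    then have "F (cnj (cnj z)) = cquat_cnj (F (cnj z))"
      using F z cnjD unfolding glued_stem_def
      by (metis cnj.sel(2) image_subset_iff le_minus_iff minus_zero nle_le)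
    then show ?thesis by (simp add: cquat_cnj_cnj)
  qed
qed

text \<open>Values below the axis are defined by reflection. The two prescriptions can conflict only
  at real points, where the conjugation clause forces the second component to vanish; it does so
  because \<open>r\<close> and \<open>s\<close> agree there.\<close>

lemma glued_stem_exists:
  assumes cnjD: "cnj ` D \<subseteq> D"
    and real: "\<And>z. z \<in> D \<Longrightarrow> Im z = 0 \<Longrightarrow> r (\<phi> J z) = s (\<phi> K z)"
  shows "\<exists>F. glued_stem J K r s D F"
proof
  let ?G = "\<lambda>z. glue_values J K (r (\<phi> J z)) (s (\<phi> K z))"
  show "glued_stem J K r s D (\<lambda>z. if Im z \<ge> 0 then ?G z else cquat_cnj (?G (cnj z)))"
    unfolding glued_stem_iff
  proof (intro ballI impI conjI)
    fix z assume z: "z \<in> D" "Im z \<ge> 0"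
    have "?G (cnj z) = cquat_cnj (?G z)" if "Im z = 0"
    proof -
      have "cnj z = z" using that by (simp add: complex_eq_iff)
      with real[OF z(1) that] show ?thesis by (simp add: glue_values_def cquat_cnj_def)
    qed
    then show "(if Im (cnj z) \<ge> 0 then ?G (cnj z) else cquat_cnj (?G (cnj (cnj z)))) =
        cquat_cnj (if Im z \<ge> 0 then ?G z else cquat_cnj (?G (cnj z)))"
      using z by auto
  qed simp
qed

lemma glued_stem_unique:
  assumes "cnj ` D \<subseteq> D" and "glued_stem J K r s D F" "glued_stem J K r s D G" and z: "z \<in> D"
  shows "F z = G z"
proof -
  have up: "F w = G w" if "w \<in> D" "Im w \<ge> 0" for w
    using assms that by (simp add: glued_stem_def)
  have cnj: "F (cnj z) = cquat_cnj (F z)" "G (cnj z) = cquat_cnj (G z)" "cnj z \<in> D"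
    using glued_stem_stem_function[OF assms(1)] assms(1-3) z by (auto simp: stem_function_def)
  show ?thesis
  proof (cases "Im z \<ge> 0")
    case False
    then have "cquat_cnj (F z) = cquat_cnj (G z)" using up[of "cnj z"] cnj by simp
    then show ?thesis by (metis cquat_cnj_cnj)
  qed (use up z in simp)
qed

section \<open>Holomorphy of the glued stem function\<close>

text \<open>Moves the holomorphic extension of \<open>r\<close> to an open set of complex numbers.
  That set contains the real points of the domain, so the extension also controls \<open>r\<close>
  up to the axis.\<close>

lemma half_slice_holomorphic_extension:
  assumes "half_slice_holomorphic I T r" and I: "I \<in> \<S>"
  obtains u U where "open U" "\<And>z. \<phi> I z \<in> T \<Longrightarrow> Im z \<ge> 0 \<Longrightarrow> z \<in> U"
    "\<And>z. \<phi> I z \<in> T \<Longrightarrow> Im z \<ge> 0 \<Longrightarrow> r (\<phi> I z) = u z"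
    "\<And>z. z \<in> U \<Longrightarrow> \<exists>A. (u has_derivative (\<lambda>w. Re w *\<^sub>R A + Im w *\<^sub>R (I * A))) (at z)"
proof -
  obtain V g where sub: "T \<inter> slice_half_plane I \<subseteq> V" and g: "slice_holomorphic_on I V g"
    and eq: "\<forall>q \<in> T \<inter> slice_half_plane I. r q = g q"
    using assms unfolding half_slice_holomorphic_def by blast
  show ?thesis
  proof (rule that[of "\<phi> I -` V" "\<lambda>z. g (\<phi> I z)"])
    show "open (\<phi> I -` V)" by (rule slice_holomorphic_on_open_vimage[OF g])
    show "\<exists>A. ((\<lambda>z. g (\<phi> I z)) has_derivative (\<lambda>w. Re w *\<^sub>R A + Im w *\<^sub>R (I * A))) (at z)"
      if "z \<in> \<phi> I -` V" for z
      using slice_holomorphic_on_has_derivative[OF g I] that by simp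
  qed (use sub eq in \<open>auto simp: slice_half_plane_eq_image_phi\<close>)
qed

lemma glued_stem_holomorphic:
  assumes D: "open D" "cnj ` D \<subseteq> D" and J: "J \<in> \<S>" and K: "K \<in> \<S>"
    and r: "half_slice_holomorphic J \<Omega> r" and s: "half_slice_holomorphic K \<Omega> s"
    and sub: "\<And>z. z \<in> D \<Longrightarrow> \<phi> J z \<in> \<Omega> \<and> \<phi> K z \<in> \<Omega>"
    and F: "glued_stem J K r s D F"
  shows "holomorphic_stem_function D F"
proof -
  from r J obtain u U where U: "open U" "\<And>z. \<phi> J z \<in> \<Omega> \<Longrightarrow> Im z \<ge> 0 \<Longrightarrow> z \<in> U"
    and ru: "\<And>z. \<phi> J z \<in> \<Omega> \<Longrightarrow> Im z \<ge> 0 \<Longrightarrow> r (\<phi> J z) = u z"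
    and u': "\<And>z. z \<in> U \<Longrightarrow> \<exists>A. (u has_derivative (\<lambda>w. Re w *\<^sub>R A + Im w *\<^sub>R (J * A))) (at z)"
    by (rule half_slice_holomorphic_extension) blast
  from s K obtain v W where W: "open W" "\<And>z. \<phi> K z \<in> \<Omega> \<Longrightarrow> Im z \<ge> 0 \<Longrightarrow> z \<in> W"
    and sv: "\<And>z. \<phi> K z \<in> \<Omega> \<Longrightarrow> Im z \<ge> 0 \<Longrightarrow> s (\<phi> K z) = v z"
    and v': "\<And>z. z \<in> W \<Longrightarrow> \<exists>A. (v has_derivative (\<lambda>w. Re w *\<^sub>R A + Im w *\<^sub>R (K * A))) (at z)"
    by (rule half_slice_holomorphic_extension) blast
  \<comment> \<open>Glued from the extensions, \<open>G\<close> is differentiable at every point of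
    the closed upper half of \<open>D\<close>, but it need not have the conjugation symmetry of
    \<open>F\<close>.\<close>
  define G where "G z = glue_values J K (u z) (v z)" for z
  have G: "\<exists>G'. (G has_derivative G') (at z) \<and> (\<forall>w. G' (\<i> * w) = cquat_mult cquat_iota (G' w))"
    if z: "z \<in> D" "Im z \<ge> 0" for z
  proof -
    obtain A where A: "(u has_derivative (\<lambda>w. Re w *\<^sub>R A + Im w *\<^sub>R (J * A))) (at z)"
      using u'[OF U(2)] sub z by blast
    obtain B where B: "(v has_derivative (\<lambda>w. Re w *\<^sub>R B + Im w *\<^sub>R (K * B))) (at z)"
      using v'[OF W(2)] sub z by blast
    have rot: "Re (\<i> * w) *\<^sub>R C + Im (\<i> * w) *\<^sub>R (L * C) = L * (Re w *\<^sub>R C + Im w *\<^sub>R (L * C))"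
      if "L \<in> \<S>" for L C w
      using that by (simp add: distrib_left imag_unit_mult_mult_self)
    let ?G' = "\<lambda>w. glue_values J K (Re w *\<^sub>R A + Im w *\<^sub>R (J * A)) (Re w *\<^sub>R B + Im w *\<^sub>R (K * B))"
    have "(G has_derivative ?G') (at z)"
      using bounded_linear.has_derivative[OF bounded_linear_glue_values has_derivative_Pair[OF A B]]
      by (simp add: G_def[abs_def])
    moreover have "?G' (\<i> * w) = cquat_mult cquat_iota (?G' w)" for w
      unfolding rot[OF J] rot[OF K] by (rule glue_values_iota[OF J K])
    ultimately show ?thesis by blast
  qed
  have FG: "F z = G z" if "z \<in> D" "Im z \<ge> 0" for z
    using F that sub[of z] by (simp add: glued_stem_iff G_def ru sv)
  show ?thesis
  proof (rule stem_Schwarz_reflection[OF D(1) glued_stem_stem_function[OF D(2) F]])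
    have "isCont G z" if "z \<in> D \<inter> {z. 0 \<le> Im z}" for z
      using G[of z] that has_derivative_continuous by blast
    then have "continuous_on (D \<inter> {z. 0 \<le> Im z}) G"
      by (simp add: continuous_at_imp_continuous_on)
    then show "continuous_on (D \<inter> {z. 0 \<le> Im z}) F"
      using FG by (subst continuous_on_cong[OF refl]) auto
    fix z assume z: "z \<in> D" "0 < Im z"
    then obtain G' where G': "(G has_derivative G') (at z)"
      "\<forall>w. G' (\<i> * w) = cquat_mult cquat_iota (G' w)"
      using G[of z] by auto
    \<comment> \<open>Agreement of \<open>F\<close> and \<open>G\<close> is known on the closed
      upper half only. Off the axis it holds in a neighbourhood, so the derivative carries over; on
      the axis only continuity is taken from \<open>G\<close>.\<close>
    have "open (D \<inter> {z. 0 < Im z})" using D by (intro open_Int open_halfspace_Im_gt)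
    with G'(1) have "(F has_derivative G') (at z)"
      by (rule has_derivative_transform_within_open) (use z in \<open>auto simp: FG\<close>)
    with G' show "\<exists>F'. (F has_derivative F') (at z) \<and>
        (\<forall>w. F' (\<i> * w) = cquat_mult cquat_iota (F' w))"
      by blast
  qed
qed

theorem theorem3p3:
  fixes \<Omega> :: "quat set" and J K :: quat and r s :: "quat \<Rightarrow> quat" and D :: "complex set"
  assumes "symmetric \<Omega>" and "open \<Omega>"
    and "J \<in> \<S>" and "K \<in> \<S>" and "J \<noteq> K"
    and "half_slice_holomorphic J \<Omega> r"
    and "half_slice_holomorphic K \<Omega> s"
    and "\<And>\<alpha>::real. of_real \<alpha> \<in> \<Omega> \<Longrightarrow> r (of_real \<alpha>) = s (of_real \<alpha>)"
    and "D = \<phi> J -` (\<Omega> \<inter> slice_plane J)"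
  shows "\<Omega> = circularization D \<and>
    cnj ` D = D \<and>
    (\<exists>F. glued_stem J K r s D F) \<and>
    (\<forall>F G. glued_stem J K r s D F \<longrightarrow> glued_stem J K r s D G \<longrightarrow> (\<forall>z\<in>D. F z = G z)) \<and>
    (\<forall>F. glued_stem J K r s D F \<longrightarrow>
       holomorphic_stem_function D F \<and>
       \<I> D F \<in> SR D \<and>
       slice_regular_on \<Omega> (\<I> D F) \<and>
       (\<forall>q \<in> \<Omega> \<inter> slice_half_plane J. r q = \<I> D F q) \<and>
       (\<forall>q \<in> \<Omega> \<inter> slice_half_plane K. s q = \<I> D F q))"
proof -
  note J = assms(3) and K = assms(4)
  have mem_D: "z \<in> D \<longleftrightarrow> \<phi> J z \<in> \<Omega>" for z
    by (auto simp: assms(9) slice_plane_eq_range_phi)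
  \<comment> \<open>Symmetry makes membership in \<open>\<Omega>\<close> independent of the unit, so
    the set \<open>D\<close> read off from the slice of \<open>J\<close> describes every
    slice.\<close>
  have mem: "\<phi> I z \<in> \<Omega> \<longleftrightarrow> z \<in> D" if "I \<in> \<S>" for I z
    using symmetric_phi[OF assms(1) that J] mem_D by simp
  have \<Omega>: "\<Omega> = circularization D"
  proof
    show "\<Omega> \<subseteq> circularization D"
    proof
      fix q assume q: "q \<in> \<Omega>"
      obtain I where "I \<in> \<S>" "q \<in> slice_plane I" by (rule quat_in_slice_plane)
      then show "q \<in> circularization D"
        using q mem by (auto simp: circularization_def slice_plane_eq_range_phi)
    qed
  qed (auto simp: circularization_def mem)
  \<comment> \<open>Conjugating the coordinate amounts to replacing \<open>J\<close> by
    \<open>- J\<close>, which is again an imaginary unit.\<close>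
  have cnj_mem: "cnj z \<in> D \<longleftrightarrow> z \<in> D" for z
    using mem[OF uminus_imag_unit[OF J]] mem_D by (simp add: phi_cnj)
  then have cnjD: "cnj ` D = D" by (force intro: image_eqI[of _ cnj "cnj z" for z])
  then have cnjD': "cnj ` D \<subseteq> D" by simp
  have openD: "open D"
  proof -
    have "D = \<phi> J -` \<Omega>" using mem_D by auto
    then show ?thesis using assms(2) by (simp add: open_vimage_phi)
  qed
  have real: "r (\<phi> J z) = s (\<phi> K z)" if "z \<in> D" "Im z = 0" for z
    using that assms(8)[of "Re z"] mem_D[of z] by (simp add: phi_def)
  have main: "holomorphic_stem_function D F \<and> \<I> D F \<in> SR D \<and> slice_regular_on \<Omega> (\<I> D F) \<and>
       (\<forall>q \<in> \<Omega> \<inter> slice_half_plane J. r q = \<I> D F q) \<and>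
       (\<forall>q \<in> \<Omega> \<inter> slice_half_plane K. s q = \<I> D F q)"
    if F: "glued_stem J K r s D F" for F
  proof (intro conjI)
    show hol: "holomorphic_stem_function D F"
      using mem[OF J] mem[OF K]
      by (intro glued_stem_holomorphic[OF openD cnjD' J K assms(6,7) _ F]) auto
    then show "\<I> D F \<in> SR D" by (auto simp: SR_def)
    show "slice_regular_on \<Omega> (\<I> D F)"
      using induced_slice_regular[OF hol] assms(2) by (simp flip: \<Omega>)
    have stem: "stem_function D F" using hol by (simp add: holomorphic_stem_function_def)
    have val: "F z = glue_values J K (r (\<phi> J z)) (s (\<phi> K z))" if "z \<in> D" "Im z \<ge> 0" for z
      using F that by (simp add: glued_stem_iff)
    show "\<forall>q \<in> \<Omega> \<inter> slice_half_plane J. r q = \<I> D F q"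
      by (auto simp: slice_half_plane_eq_image_phi mem[OF J] induced_eq[OF stem _ J] val
          glue_values_solves[OF J K assms(5)])
    show "\<forall>q \<in> \<Omega> \<inter> slice_half_plane K. s q = \<I> D F q"
      by (auto simp: slice_half_plane_eq_image_phi mem[OF K] induced_eq[OF stem _ K] val
          glue_values_solves[OF J K assms(5)])
  qed
  show ?thesis
    using \<Omega> cnjD glued_stem_exists[of D r J s K, OF cnjD' real]
      glued_stem_unique[of D, OF cnjD'] main
    by blast
qed

end
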